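(* Let $p\ge 0$ be an integer, $N=(p+1)^2$, and let $\phi_1,\dots,\phi_N$ be linearly independent real polynomials in $\mathbf{x}=(x,y)\in\mathbb{R}^2$; write $\boldsymbol{\phi}(\mathbf{x})=[\phi_1(\mathbf{x}),\dots,\phi_N(\mathbf{x})]^T\in\mathbb{R}^N$. Let $\Omega_b\subset\mathbb{R}^2$ be the boundary element (a bounded measurable set with nonempty interior) and let $M\in\mathbb{R}^{N\times N}$ be its mass matrix, $M_{mn}=\int_{\Omega_b}\phi_m(\mathbf{x})\phi_n(\mathbf{x})\,d\mathbf{x}$. Let $K\ge 1$, let $\bar{\mathbf{x}}_1,\dots,\bar{\mathbf{x}}_K\in\mathbb{R}^2$ be points on the real boundary, and let $\Phi=\Phi(\bar{\mathbf{x}})\in\mathbb{R}^{N\times K}$ be the matrix with entries $\Phi_{jk}=\phi_j(\bar{\mathbf{x}}_k)$. Assume that the matrix $$\begin{bmatrix} M & \Phi\\ \Phi^T & 0\end{bmatrix}$$ is invertible. Let $\tilde{\mathbf{x}}\in\mathbb{R}^2$ be a point on the computational boundary. For every $\mathbf{u}\in\mathbb{R}^N$ and $\mathbf{u}_D\in\mathbb{R}^K$, let $(\mathbf{v},\boldsymbol{\lambda})\in\mathbb{R}^N\times\mathbb{R}^K$ be the solution of the ROD2D-$L^2$ linear system $$\begin{bmatrix} M & \Phi\\ \Phi^T & 0\end{bmatrix}\begin{bmatrix}\mathbf{v}\\ \boldsymbol{\lambda}\end{bmatrix}=\begin{bmatrix}M\mathbf{u}\\ \mathbf{u}_D\end{bmatrix},$$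 and let $v_h(\mathbf{x})=\boldsymbol{\phi}(\mathbf{x})^T\mathbf{v}$. Then computing $v_h(\tilde{\mathbf{x}})$ in this way is equivalent to the polynomial correction $$v_h(\tilde{\mathbf{x}})=[\boldsymbol{\phi}^{\text{ROD2D-}L^2}(\tilde{\mathbf{x}})]^T\mathbf{u}+[\boldsymbol{\alpha}^{\text{ROD2D-}L^2}]^T\mathbf{u}_D,$$ i.e. this equality holds for all $\mathbf{u}$ and $\mathbf{u}_D$, where $$[\boldsymbol{\alpha}^{\text{ROD2D-}L^2}]^T=\boldsymbol{\phi}(\tilde{\mathbf{x}})^TM^{-1}\Phi\,(\Phi^TM^{-1}\Phi)^{-1},\qquad \boldsymbol{\phi}^{\text{ROD2D-}L^2}(\tilde{\mathbf{x}})=\boldsymbol{\phi}(\tilde{\mathbf{x}})-\Phi\,\boldsymbol{\alpha}^{\text{ROD2D-}L^2}.$$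
   Context: Setting: in a two-dimensional discontinuous Galerkin method, the numerical solution in a boundary element $\Omega_b$ is $u_h(\mathbf{x})=\boldsymbol{\phi}(\mathbf{x})^T\mathbf{u}$, a polynomial approximation of degree $p$ with coefficient vector $\mathbf{u}\in\mathbb{R}^N$, $N=(p+1)^2$. Basis functions are polynomials and are evaluated also outside the element. Dirichlet values $\mathbf{u}_D=[u_D(\bar{\mathbf{x}}_1),\dots,u_D(\bar{\mathbf{x}}_K)]^T$ are prescribed at $K$ points $\bar{\mathbf{x}}_k$ of the real boundary, which need not coincide with the computational boundary. The ROD2D-$L^2$ (Reconstruction for Off-site Data, $L^2$ distance, multiple constraints) method defines a modified polynomial $v_h(\mathbf{x})=\boldsymbol{\phi}(\mathbf{x})^T\mathbf{v}$ whose coefficients minimize $\frac12\int_{\Omega_b}(v_h(\mathbf{x})-u_h(\mathbf{x}))^2\,d\mathbf{x}$ subject to $v_h(\bar{\mathbf{x}}_k)=u_D(\bar{\mathbf{x}}_k)$ for $k=1,\dots,K$. The linear system in the claim consists of the optimality conditions of the Lagrangian $\mathcal{L}(\mathbf{v},\boldsymbol{\lambda})=\frac12\int_{\Omega_b}(v_h-u_h)^2\,d\mathbf{x}+\sum_{k=1}^K\lambda_k(v_h(\bar{\mathbf{x}}_k)-u_D(\bar{\mathbf{x}}_k))$. The value $v_h(\tilde{\mathbf{x}})$ is the modified boundary condition imposed at $\tilde{\mathbf{x}}$. *)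

theory Defs
  imports "HOL-Analysis.Analysis"
begin

text \<open>
  The basis is a vector-valued map \<open>\<phi> :: real^2 \<Rightarrow> real^'n\<close>; linear independence of its components
  is taken over the reals, as functions on the whole plane. For polynomials this is the same as
  linear independence of the formal polynomials.
\<close>

definition lin_indep_components :: "('a \<Rightarrow> real^'n) \<Rightarrow> bool" where
  "lin_indep_components \<phi> \<longleftrightarrow>
     (\<forall>c::real^'n. (\<forall>x. (\<Sum>j\<in>UNIV. c $ j * \<phi> x $ j) = 0) \<longrightarrow> c = 0)"

definition mass_matrix :: "(real^2) set \<Rightarrow> (real^2 \<Rightarrow> real^'n) \<Rightarrow> real^'n^'n" where
  "mass_matrix \<Omega> \<phi> = (\<chi> m n. LINT x:\<Omega>|lebesgue. \<phi> x $ m * \<phi> x $ n)"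

definition collocation_matrix :: "(real^2 \<Rightarrow> real^'n) \<Rightarrow> ('k::finite \<Rightarrow> real^2) \<Rightarrow> real^'k^'n" where
  "collocation_matrix \<phi> xbar = (\<chi> j k. \<phi> (xbar k) $ j)"

text \<open>Block vectors and matrices are indexed by the disjoint sum of the block index types.\<close>

definition block_vec :: "'a^'n \<Rightarrow> 'a^'k \<Rightarrow> 'a^('n + 'k)" where
  "block_vec v w = (\<chi> i. case i of Inl a \<Rightarrow> v $ a | Inr b \<Rightarrow> w $ b)"

definition block_mat ::
  "'a^'n^'m \<Rightarrow> 'a^'k^'m \<Rightarrow> 'a^'n^'l \<Rightarrow> 'a^'k^'l \<Rightarrow> 'a^('n + 'k)^('m + 'l)" where
  "block_mat A B C D =
     (\<chi> i. case i of Inl a \<Rightarrow> block_vec (A $ a) (B $ a) | Inr b \<Rightarrow> block_vec (C $ b) (D $ b))"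

definition rod_matrix ::
  "(real^2) set \<Rightarrow> (real^2 \<Rightarrow> real^'n) \<Rightarrow> ('k::finite \<Rightarrow> real^2) \<Rightarrow> real^('n + 'k)^('n + 'k)" where
  "rod_matrix \<Omega> \<phi> xbar =
     block_mat (mass_matrix \<Omega> \<phi>) (collocation_matrix \<phi> xbar)
               (transpose (collocation_matrix \<phi> xbar)) 0"

definition rod_solution ::
  "(real^2) set \<Rightarrow> (real^2 \<Rightarrow> real^'n) \<Rightarrow> ('k::finite \<Rightarrow> real^2) \<Rightarrow>
   real^'n \<Rightarrow> real^'k \<Rightarrow> real^'n \<Rightarrow> real^'k \<Rightarrow> bool" where
  "rod_solution \<Omega> \<phi> xbar u uD v lam \<longleftrightarrow>
     rod_matrix \<Omega> \<phi> xbar *v block_vec v lam = block_vec (mass_matrix \<Omega> \<phi> *v u) uD"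

definition schur_matrix ::
  "(real^2) set \<Rightarrow> (real^2 \<Rightarrow> real^'n) \<Rightarrow> ('k::finite \<Rightarrow> real^2) \<Rightarrow> real^'k^'k" where
  "schur_matrix \<Omega> \<phi> xbar =
     transpose (collocation_matrix \<phi> xbar) ** matrix_inv (mass_matrix \<Omega> \<phi>)
       ** collocation_matrix \<phi> xbar"

text \<open>The operator \<open>v*\<close> multiplies a row vector by a matrix from the right.\<close>

definition rod_alpha ::
  "(real^2) set \<Rightarrow> (real^2 \<Rightarrow> real^'n) \<Rightarrow> ('k::finite \<Rightarrow> real^2) \<Rightarrow> real^2 \<Rightarrow> real^'k" where
  "rod_alpha \<Omega> \<phi> xbar xt =
     \<phi> xt v* (matrix_inv (mass_matrix \<Omega> \<phi>) ** collocation_matrix \<phi> xbar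
              ** matrix_inv (schur_matrix \<Omega> \<phi> xbar))"

definition rod_phi ::
  "(real^2) set \<Rightarrow> (real^2 \<Rightarrow> real^'n) \<Rightarrow> ('k::finite \<Rightarrow> real^2) \<Rightarrow> real^2 \<Rightarrow> real^'n" where
  "rod_phi \<Omega> \<phi> xbar xt = \<phi> xt - collocation_matrix \<phi> xbar *v rod_alpha \<Omega> \<phi> xbar xt"

definition poly_expansion :: "(real^2 \<Rightarrow> real^'n) \<Rightarrow> real^'n \<Rightarrow> real^2 \<Rightarrow> real" where
  "poly_expansion \<phi> v x = \<phi> x \<bullet> v"

end

theory Submission imports Defs begin

text \<open>
  The mass matrix is positive definite: \<open>c \<bullet> M c\<close> is the integral of \<open>(\<phi> \<bullet> c)\<^sup>2\<close> over the element,
  and a polynomial that vanishes almost everywhere on a set with nonempty interior is zero.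
  Eliminating \<open>v = u - M\<^sup>-\<^sup>1 \<Phi> \<lambda>\<close> from the saddle-point system leaves \<open>S \<lambda> = \<Phi>\<^sup>T u - u\<^sub>D\<close> with the Schur
  complement \<open>S = \<Phi>\<^sup>T M\<^sup>-\<^sup>1 \<Phi>\<close>, which inherits a trivial kernel from the saddle-point matrix.
\<close>

text \<open>Restricting f to the line through \<open>x0\<close> and x gives a univariate polynomial.
  The line meets \<open>U\<close> for infinitely many parameters, so all its coefficients vanish and
  f is zero along the whole line.\<close>

lemma real_polynomial_function_eq_0_on_open:
  fixes f :: "'a::real_normed_vector \<Rightarrow> real"
  assumes f: "real_polynomial_function f" and U: "open U" "x0 \<in> U"
    and zero: "\<And>x. x \<in> U \<Longrightarrow> f x = 0"
  shows "f x = 0"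
proof -
  \<comment> \<open>The parametrization has \<open>l 0 = x0\<close>, inside \<open>U\<close>, and
    \<open>l 1 = x\<close>, the point at which the value is wanted.\<close>
  define l where "l t = x0 + t *\<^sub>R (x - x0)" for t :: real
  have "polynomial_function l"
    unfolding l_def
    by (intro polynomial_function_add polynomial_function_const polynomial_function_mult
        polynomial_function_id)
  then have "real_polynomial_function (f \<circ> l)"
    using f by (rule real_polynomial_function_compose)
  then obtain a n where an: "f \<circ> l = (\<lambda>t. \<Sum>i\<le>n. a i * t ^ i)"
    by (auto simp: real_polynomial_function_iff_sum)
  have "continuous_on UNIV l"
    unfolding l_def by (intro continuous_intros)
  then have "open (l -` U)"
    using U by (simp add: open_vimage)
  moreover have "0 \<in> l -` U"
    using U by (simp add: l_def)
  ultimately have "infinite (l -` U)"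
    using finite_imp_not_open by blast
  moreover have "l -` U \<subseteq> {t. (\<Sum>i\<le>n. a i * t ^ i) = 0}"
    using zero by (auto simp flip: fun_cong[OF an])
  ultimately have "\<forall>k\<le>n. a k = 0"
    using polyfun_finite_roots[of a n] finite_subset by blast
  then have "(f \<circ> l) 1 = 0"
    unfolding an by simp
  then show ?thesis
    by (simp add: l_def)
qed

text \<open>A bounded set lies in a box, where continuity gives absolute integrability; this passes
  to measurable subsets.\<close>

lemma set_integrable_lebesgue_bounded:
  fixes f :: "'a::euclidean_space \<Rightarrow> 'b::euclidean_space"
  assumes "bounded S" "S \<in> sets lebesgue" "continuous_on UNIV f"
  shows "set_integrable lebesgue S f"
proof -
  obtain a where "S \<subseteq> cbox (-a) a"
    using bounded_subset_cbox_symmetric assms(1) by blast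
  moreover have "set_integrable lebesgue (cbox (-a) a) f"
    using assms(3) by (intro absolutely_integrable_continuous) (rule continuous_on_subset, auto)
  ultimately show ?thesis
    using assms(2) set_integrable_subset by blast
qed

lemma continuous_on_real_polynomial_function:
  "real_polynomial_function f \<Longrightarrow> continuous_on S f"
  by (simp add: continuous_at_imp_continuous_on continuous_real_polymonial_function)

lemma inner_mass_matrix:
  assumes "\<And>j. real_polynomial_function (\<lambda>x. \<phi> x $ j)"
    and "bounded \<Omega>" "\<Omega> \<in> sets lebesgue"
  shows "c \<bullet> (mass_matrix \<Omega> \<phi> *v c) = (LINT x:\<Omega>|lebesgue. (\<phi> x \<bullet> c)\<^sup>2)"
proof -
  \<comment> \<open>Termwise integrability is what permits exchanging the double sum of the
    quadratic form with the integral.\<close>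
  have int: "integrable lebesgue (\<lambda>x. c $ m * c $ n * (indicator \<Omega> x * (\<phi> x $ m * \<phi> x $ n)))" for m n
  proof -
    have "continuous_on UNIV (\<lambda>x. \<phi> x $ m * \<phi> x $ n)"
      using assms(1)
      by (intro continuous_on_mult continuous_on_real_polynomial_function)
    then have "integrable lebesgue (\<lambda>x. indicator \<Omega> x * (\<phi> x $ m * \<phi> x $ n))"
      using set_integrable_lebesgue_bounded[OF assms(2,3)] by (fastforce simp: set_integrable_def)
    then show ?thesis
      by (rule integrable_mult_right)
  qed
  have "c \<bullet> (mass_matrix \<Omega> \<phi> *v c) =
      (\<Sum>m\<in>UNIV. \<Sum>n\<in>UNIV. LINT x|lebesgue. c $ m * c $ n * (indicator \<Omega> x * (\<phi> x $ m * \<phi> x $ n)))"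
    by (simp add: inner_vec_def matrix_vector_mult_def mass_matrix_def sum_distrib_left
        set_lebesgue_integral_def mult_ac)
  also have "\<dots> = (LINT x|lebesgue. (\<Sum>m\<in>UNIV. \<Sum>n\<in>UNIV.
      c $ m * c $ n * (indicator \<Omega> x * (\<phi> x $ m * \<phi> x $ n))))"
    using int by simp
  also have "\<dots> = (LINT x:\<Omega>|lebesgue. (\<phi> x \<bullet> c)\<^sup>2)"
    by (simp add: set_lebesgue_integral_def inner_vec_def power2_eq_square sum_product
        sum_distrib_left mult_ac)
  finally show ?thesis .
qed

lemma real_polynomial_function_inner_const:
  fixes \<phi> :: "'a::real_normed_vector \<Rightarrow> real^'n"
  assumes "\<And>j. real_polynomial_function (\<lambda>x. \<phi> x $ j)"
  shows "real_polynomial_function (\<lambda>x. \<phi> x \<bullet> c)"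
  unfolding inner_vec_def using assms by (auto intro!: real_polynomial_function_sum)

lemma invertible_iff_trivial_kernel:
  fixes A :: "'a::field^'n^'n"
  shows "invertible A \<longleftrightarrow> (\<forall>x. A *v x = 0 \<longrightarrow> x = 0)"
  by (simp add: invertible_left_inverse matrix_left_invertible_ker)

lemma invertible_mass_matrix:
  assumes poly: "\<And>j. real_polynomial_function (\<lambda>x. \<phi> x $ j)"
    and indep: "lin_indep_components \<phi>"
    and \<Omega>: "bounded \<Omega>" "\<Omega> \<in> sets lebesgue" "interior \<Omega> \<noteq> {}"
  shows "invertible (mass_matrix \<Omega> \<phi>)"
  unfolding invertible_iff_trivial_kernel
proof (intro allI impI)
  fix c assume "mass_matrix \<Omega> \<phi> *v c = 0"
  then have "(LINT x:\<Omega>|lebesgue. (\<phi> x \<bullet> c)\<^sup>2) = 0"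
    using inner_mass_matrix[OF poly \<Omega>(1,2), of c] by simp
  moreover have cont: "continuous_on S (\<lambda>x. \<phi> x \<bullet> c)" for S
    using poly by (intro continuous_on_real_polynomial_function real_polynomial_function_inner_const)
  then have "set_integrable lebesgue \<Omega> (\<lambda>x. (\<phi> x \<bullet> c)\<^sup>2)"
    using \<Omega> by (intro set_integrable_lebesgue_bounded continuous_on_power)
  \<comment> \<open>A nonnegative integrable function with zero integral vanishes almost
    everywhere.\<close>
  ultimately have "AE x in lebesgue. indicator \<Omega> x * (\<phi> x \<bullet> c)\<^sup>2 = 0"
    by (subst integral_nonneg_eq_0_iff_AE[symmetric])
      (auto simp: set_integrable_def set_lebesgue_integral_def)
  then have "AE x\<in>interior \<Omega> in lebesgue. x \<in> {x. \<phi> x \<bullet> c = 0}"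
    using interior_subset[of \<Omega>] by (auto elim!: eventually_mono simp: indicator_def split: if_splits)
  moreover have "closed {x. \<phi> x \<bullet> c = 0}"
    using cont[of UNIV] by (intro closed_Collect_eq) auto
  \<comment> \<open>A closed set that contains almost every point of an open set contains all of it.
    Passing to the interior thus removes the exceptional null set.\<close>
  ultimately have "\<phi> x \<bullet> c = 0" if "x \<in> interior \<Omega>" for x
    using mem_closed_if_AE_lebesgue_open[OF open_interior _ _ that] by blast
  moreover obtain x0 where "x0 \<in> interior \<Omega>"
    using \<Omega>(3) by blast
  ultimately have "\<phi> x \<bullet> c = 0" for x
    using real_polynomial_function_eq_0_on_open[OF real_polynomial_function_inner_const[OF poly]]
    by (metis open_interior)
  then show "c = 0"
    using indep by (simp add: lin_indep_components_def inner_vec_def mult.commute)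
qed

lemma sum_UNIV_Plus:
  fixes f :: "'a::finite + 'b::finite \<Rightarrow> 'c::comm_monoid_add"
  shows "sum f UNIV = (\<Sum>a\<in>UNIV. f (Inl a)) + (\<Sum>b\<in>UNIV. f (Inr b))"
  by (simp add: UNIV_Plus_UNIV[symmetric] sum.Plus del: UNIV_Plus_UNIV)

lemma block_mat_mult_block_vec:
  "block_mat A B C D *v block_vec v w = block_vec (A *v v + B *v w) (C *v v + D *v w)"
  by (auto simp: vec_eq_iff block_mat_def block_vec_def matrix_vector_mult_def sum_UNIV_Plus
      split: sum.split)

lemma block_vec_eq_iff: "block_vec v w = block_vec v' w' \<longleftrightarrow> v = v' \<and> w = w'"
  by (auto simp: block_vec_def vec_eq_iff split: sum.splits)

lemma block_vec_eq_0_iff: "block_vec v w = 0 \<longleftrightarrow> v = 0 \<and> w = 0"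
  by (auto simp: block_vec_def vec_eq_iff split: sum.splits)

text \<open>Lets a solution indexed by the sum type be read as a pair, so that invertibility yields
  a unique pair.\<close>

lemma ex_block_vec: "\<exists>v w. x = block_vec v w"
  by (rule exI[of _ "\<chi> i. x $ Inl i"], rule exI[of _ "\<chi> i. x $ Inr i"])
    (simp add: block_vec_def vec_eq_iff split: sum.split)

text \<open>\<open>matrix_inv\<close> is defined by choice; invertibility ensures that the chosen
  matrix is a two-sided inverse.\<close>

lemma matrix_inv_mult_vec:
  assumes "invertible A"
  shows "A *v (matrix_inv A *v x) = x" and "matrix_inv A *v (A *v x) = x"
  using someI_ex[OF assms[unfolded invertible_def]]
  by (simp_all add: matrix_inv_def matrix_vector_mul_assoc)

text \<open>A kernel vector \<open>w\<close> of the Schur complement lifts to the kernel vector of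
  the block matrix with components \<open>matrix_inv A *v (B *v w)\<close> and \<open>- w\<close>:
  the first row cancels, and the second is the Schur complement applied to \<open>w\<close>.\<close>

lemma invertible_Schur_complement:
  fixes A :: "'a::field^'n^'n" and B :: "'a^'k^'n" and C :: "'a^'n^'k"
  assumes A: "invertible A" and inv: "invertible (block_mat A B C 0)"
  shows "invertible (C ** matrix_inv A ** B)"
  unfolding invertible_iff_trivial_kernel
proof (intro allI impI)
  fix w assume w: "(C ** matrix_inv A ** B) *v w = 0"
  have "block_mat A B C 0 *v block_vec (matrix_inv A *v (B *v w)) (- w) = 0"
    using w A by (simp add: block_mat_mult_block_vec block_vec_eq_0_iff matrix_inv_mult_vec
        matrix_vector_mul_assoc[symmetric] vec.neg)
  then show "w = 0"
    using inv unfolding invertible_iff_trivial_kernel by (auto simp: block_vec_eq_0_iff)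
qed

lemma block_mat_unique_solution:
  fixes A :: "'a::field^'n^'n" and D :: "'a^'k^'k"
  assumes "invertible (block_mat A B C D)"
  shows "\<exists>!(v, w). block_mat A B C D *v block_vec v w = b"
proof -
  let ?R = "block_mat A B C D"
  obtain v w where vw: "matrix_inv ?R *v b = block_vec v w"
    using ex_block_vec by blast
  have "?R *v x = b \<longleftrightarrow> x = block_vec v w" for x
    using matrix_inv_mult_vec[OF assms] vw by metis
  then show ?thesis
    by (auto simp: block_vec_eq_iff)
qed

text \<open>The two invertibility claims make \<open>matrix_inv\<close> in \<open>rod_alpha\<close>
  a genuine inverse, and unique solvability justifies speaking of the solution of the
  system.\<close>

theorem proposition5p4:
  fixes p :: nat
    and \<phi> :: "real^2 \<Rightarrow> real^'n"
    and \<Omega> :: "(real^2) set"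
    and xbar :: "'k::finite \<Rightarrow> real^2"
    and xt :: "real^2"
  assumes "CARD('n) = (p + 1)^2"
    and "\<And>j. real_polynomial_function (\<lambda>x. \<phi> x $ j)"
    and "lin_indep_components \<phi>"
    and "bounded \<Omega>" and "\<Omega> \<in> sets lebesgue" and "interior \<Omega> \<noteq> {}"
    and "invertible (rod_matrix \<Omega> \<phi> xbar)"
  shows "invertible (mass_matrix \<Omega> \<phi>) \<and> invertible (schur_matrix \<Omega> \<phi> xbar) \<and>
    (\<forall>u uD. (\<exists>!(v, lam). rod_solution \<Omega> \<phi> xbar u uD v lam) \<and>
      (\<forall>v lam. rod_solution \<Omega> \<phi> xbar u uD v lam \<longrightarrow>
        poly_expansion \<phi> v xt = rod_phi \<Omega> \<phi> xbar xt \<bullet> u + rod_alpha \<Omega> \<phi> xbar xt \<bullet> uD))"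
proof -
  let ?M = "mass_matrix \<Omega> \<phi>" and ?\<Phi> = "collocation_matrix \<phi> xbar"
    and ?S = "schur_matrix \<Omega> \<phi> xbar"
  have M: "invertible ?M"
    using assms(2-6) by (rule invertible_mass_matrix)
  have S: "invertible ?S"
    using assms(7) invertible_Schur_complement[OF M]
    by (simp add: rod_matrix_def schur_matrix_def)
  have "\<exists>!(v, lam). rod_solution \<Omega> \<phi> xbar u uD v lam" for u uD
    using assms(7) block_mat_unique_solution unfolding rod_solution_def rod_matrix_def by blast
  moreover have "poly_expansion \<phi> v xt = rod_phi \<Omega> \<phi> xbar xt \<bullet> u + rod_alpha \<Omega> \<phi> xbar xt \<bullet> uD"
    if "rod_solution \<Omega> \<phi> xbar u uD v lam" for u uD v lam
  proof -
    have eqs: "?M *v v + ?\<Phi> *v lam = ?M *v u" "transpose ?\<Phi> *v v = uD"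
      using that
      by (simp_all add: rod_solution_def rod_matrix_def block_mat_mult_block_vec block_vec_eq_iff
          del: transpose_matrix_vector)
    have "?M *v (u - v) = ?\<Phi> *v lam"
      using eqs(1) by (simp add: matrix_vector_mult_diff_distrib algebra_simps)
    then have uv: "u - v = matrix_inv ?M *v (?\<Phi> *v lam)"
      by (metis matrix_inv_mult_vec(2)[OF M])
    then have "?S *v lam = transpose ?\<Phi> *v (u - v)"
      by (simp add: schur_matrix_def matrix_vector_mul_assoc[symmetric] del: transpose_matrix_vector)
    also have "\<dots> = transpose ?\<Phi> *v u - uD"
      using eqs(2) by (simp add: matrix_vector_mult_diff_distrib del: transpose_matrix_vector)
    finally have "lam = matrix_inv ?S *v (transpose ?\<Phi> *v u - uD)"
      by (metis matrix_inv_mult_vec(2)[OF S])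
    \<comment> \<open>Inserting \<open>lam\<close> into \<open>uv\<close> applies the matrix product
      from \<open>rod_alpha\<close> to the residual of \<open>u\<close> in the constraints; moving
      that product onto \<open>\<phi> xt\<close> produces \<open>rod_alpha\<close>.\<close>
    then have "\<phi> xt \<bullet> (u - v) = rod_alpha \<Omega> \<phi> xbar xt \<bullet> (transpose ?\<Phi> *v u - uD)"
      by (simp add: uv rod_alpha_def dot_lmul_matrix matrix_vector_mul_assoc[symmetric]
          del: transpose_matrix_vector)
    \<comment> \<open>Passing to the adjoint collects all terms in \<open>u\<close> into
      \<open>rod_phi\<close>, leaving \<open>rod_alpha\<close> paired with
      \<open>uD\<close>.\<close>
    moreover have "rod_alpha \<Omega> \<phi> xbar xt \<bullet> (transpose ?\<Phi> *v u) =
        (?\<Phi> *v rod_alpha \<Omega> \<phi> xbar xt) \<bullet> u"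
      by (metis dot_lmul_matrix inner_commute transpose_matrix_vector)
    ultimately show ?thesis
      by (simp add: poly_expansion_def rod_phi_def inner_diff_left inner_diff_right)
  qed
  ultimately show ?thesis
    using M S by blast
qed

end
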